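(* Let $\lambda$ be a partition and $n$ a positive integer. The vertices of $P(\lambda,n)$ are exactly the matrices in $M(\lambda,n)$.
   Context: A partition $\lambda=[\lambda_1,\ldots,\lambda_k]$ is a weakly decreasing sequence of positive integers; $a_i$ denotes the number of parts equal to $i$. A sign matrix is a matrix with entries in $\{-1,0,1\}$ all of whose column partial sums from the top $\sum_{i'=1}^{i}M_{i'j}$ lie in $\{0,1\}$ and all of whose row partial sums from the left $\sum_{j'=1}^{j}M_{ij'}$ are nonnegative. $M(\lambda,n)$ is the set of $\lambda_1\times n$ sign matrices whose $i$-th row sums to $a_{\lambda_1-i+1}$ for each $1\le i\le\lambda_1$, and $P(\lambda,n)$ is its convex hull in $\mathbb{R}^{\lambda_1 n}$. *)

theory Defs
  imports "HOL-Analysis.Polytope" "HOL-Analysis.Finite_Function_Topology"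
begin

text \<open>
  Since \<open>m\<close> and \<open>n\<close> vary with the data, an \<open>m \<times> n\<close> real matrix is a finitely supported function on
  pairs of naturals that vanishes outside \<open>{1..m} \<times> {1..n}\<close>; rows and columns are counted from 1,
  row 1 being the top row and column 1 the leftmost one. These matrices form a linear
  copy of \<open>\<real>\<^sup>m\<^sup>n\<close> in the real vector space \<open>nat \<times> nat \<Rightarrow>\<^sub>0 real\<close>, so convex hulls and extreme points
  computed there are the intended ones.
\<close>

type_synonym rmatrix = "nat \<times> nat \<Rightarrow>\<^sub>0 real"

abbreviation entry :: "rmatrix \<Rightarrow> nat \<Rightarrow> nat \<Rightarrow> real" where
  "entry M i j \<equiv> Poly_Mapping.lookup M (i, j)"

definition matrices :: "nat \<Rightarrow> nat \<Rightarrow> rmatrix set" where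
  "matrices m n = {M. Poly_Mapping.keys M \<subseteq> {1..m} \<times> {1..n}}"

definition is_partition :: "nat list \<Rightarrow> bool" where
  "is_partition lam \<longleftrightarrow> sorted_wrt (\<ge>) lam \<and> (\<forall>p\<in>set lam. 0 < p)"

text \<open>The empty partition is allowed; its first part is taken to be 0.\<close>

definition largest_part :: "nat list \<Rightarrow> nat" where
  "largest_part lam = (case lam of [] \<Rightarrow> 0 | p # _ \<Rightarrow> p)"

definition sign_matrix :: "nat \<Rightarrow> nat \<Rightarrow> rmatrix \<Rightarrow> bool" where
  "sign_matrix m n M \<longleftrightarrow>
     M \<in> matrices m n \<and>
     (\<forall>i\<in>{1..m}. \<forall>j\<in>{1..n}. entry M i j \<in> {-1, 0, 1}) \<and>
     (\<forall>i\<in>{1..m}. \<forall>j\<in>{1..n}. (\<Sum>i'=1..i. entry M i' j) \<in> {0, 1}) \<and>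
     (\<forall>i\<in>{1..m}. \<forall>j\<in>{1..n}. 0 \<le> (\<Sum>j'=1..j. entry M i j'))"

text \<open>The multiplicity \<open>a\<^sub>k\<close> of the part \<open>k\<close> is \<open>count_list lam k\<close>.\<close>

definition sign_matrices_of :: "nat list \<Rightarrow> nat \<Rightarrow> rmatrix set" where
  "sign_matrices_of lam n =
     {M. sign_matrix (largest_part lam) n M \<and>
         (\<forall>i\<in>{1..largest_part lam}.
            (\<Sum>j=1..n. entry M i j) = real (count_list lam (largest_part lam - i + 1)))}"

definition sign_matrix_polytope :: "nat list \<Rightarrow> nat \<Rightarrow> rmatrix set" where
  "sign_matrix_polytope lam n = convex hull (sign_matrices_of lam n)"

end

theory Submission
  imports Defs
begin

text \<open>
  The column partial sums are linear functionals that determine a matrix and take only the values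
  0 and 1 on sign matrices, so they embed the sign matrices as vertices of a cube. A vertex of
  the cube is extreme in every convex set inside the cube that contains it.
\<close>

lemma extreme_points_convex_hull_zero_one:
  fixes S :: "'a::real_vector set" and f :: "'k \<Rightarrow> 'a \<Rightarrow> real"
  assumes lin: "\<And>k. k \<in> K \<Longrightarrow> linear (f k)"
    and zero_one: "\<And>k x. k \<in> K \<Longrightarrow> x \<in> S \<Longrightarrow> f k x \<in> {0, 1}"
    and sep: "\<And>x y. x \<in> convex hull S \<Longrightarrow> y \<in> convex hull S \<Longrightarrow>
                (\<And>k. k \<in> K \<Longrightarrow> f k x = f k y) \<Longrightarrow> x = y"
  shows "{x. x extreme_point_of (convex hull S)} = S"
proof (intro subset_antisym subsetI)
  fix x assume "x \<in> {x. x extreme_point_of (convex hull S)}"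
  then show "x \<in> S" by (simp add: extreme_point_of_convex_hull)
next
  fix x assume x: "x \<in> S"
  \<comment> \<open>A linear preimage of the interval from 0 to 1 is convex and contains
    \<open>S\<close>, so the whole hull lands in the cube.\<close>
  have bounds: "f k y \<in> {0..1}" if k: "k \<in> K" and y: "y \<in> convex hull S" for k y
  proof -
    have "convex (f k -` {0..1})"
      by (intro convex_linear_vimage lin k convex_real_interval)
    moreover have "S \<subseteq> f k -` {0..1}"
      using zero_one[OF k] by force
    ultimately have "convex hull S \<subseteq> f k -` {0..1}"
      by (rule hull_minimal[rotated])
    then show ?thesis using y by auto
  qed
  have "x \<notin> open_segment a b" if a: "a \<in> convex hull S" and b: "b \<in> convex hull S" for a b
  proof
    assume "x \<in> open_segment a b"
    then obtain u where "a \<noteq> b" and u: "0 < u" "u < 1" and xu: "x = (1 - u) *\<^sub>R a + u *\<^sub>R b"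
      by (auto simp: in_segment)
    have "f k a = f k b" if k: "k \<in> K" for k
    proof -
      have eq: "f k x = (1 - u) * f k a + u * f k b"
        using lin[OF k] by (simp add: xu linear_add linear_scale)
      have "0 \<le> f k a" "f k a \<le> 1" "0 \<le> f k b" "f k b \<le> 1"
        using bounds[OF k a] bounds[OF k b] by auto
      \<comment> \<open>The value at \<open>x\<close> is a weighted mean of two values in the unit
        interval. The first two products measure the distances from 0 and settle the case where this
        mean is 0; the last two measure the distances from 1 and settle the other case.\<close>
      then have n: "0 \<le> (1 - u) * f k a" "0 \<le> u * f k b"
          "0 \<le> (1 - u) * (1 - f k a)" "0 \<le> u * (1 - f k b)"
        using u by auto
      consider "f k x = 0" | "f k x = 1" using zero_one[OF k x] by auto
      then show ?thesis
      proof cases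
        case 1
        then have "(1 - u) * f k a = 0" "u * f k b = 0" using eq n by linarith+
        then show ?thesis using u by auto
      next
        case 2
        \<comment> \<open>The weights \<open>1 - u\<close> and \<open>u\<close> add up to 1, so this
          is \<open>1 - f k x\<close>.\<close>
        then have "(1 - u) * (1 - f k a) + u * (1 - f k b) = 0"
          using eq by (simp add: algebra_simps)
        then have "(1 - u) * (1 - f k a) = 0" "u * (1 - f k b) = 0" using n by linarith+
        then show ?thesis using u by auto
      qed
    qed
    with sep[OF a b] \<open>a \<noteq> b\<close> show False by blast
  qed
  then show "x \<in> {x. x extreme_point_of (convex hull S)}"
    using x by (auto simp: extreme_point_of_def hull_inc)
qed

text \<open>Scaling cannot enlarge the support, so the scaled function is again finitely supported
  and may be evaluated pointwise.\<close>

lemma lookup_scaleR [simp]: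
  "Poly_Mapping.lookup (r *\<^sub>R M) p = r *\<^sub>R Poly_Mapping.lookup M p"
proof -
  have "finite {p. r *\<^sub>R Poly_Mapping.lookup M p \<noteq> 0}"
    by (rule finite_subset[OF _ finite_keys[of M]]) (auto simp: in_keys_iff)
  then show ?thesis by (simp add: scaleR_poly_mapping_def)
qed

text \<open>Keeps convex combinations of sign matrices within the given format, so that
  \<open>matrices_eqI\<close> applies to all points of the hull.\<close>

lemma convex_matrices: "convex (matrices m n)"
proof (rule convexI)
  fix A B and u v :: real
  assume AB: "A \<in> matrices m n" "B \<in> matrices m n"
  have "Poly_Mapping.keys (u *\<^sub>R A + v *\<^sub>R B) \<subseteq> Poly_Mapping.keys A \<union> Poly_Mapping.keys B"
    by (auto simp: in_keys_iff lookup_add)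
  also have "\<dots> \<subseteq> {1..m} \<times> {1..n}"
    using AB by (simp add: matrices_def)
  finally show "u *\<^sub>R A + v *\<^sub>R B \<in> matrices m n"
    by (simp add: matrices_def)
qed

text \<open>Each entry is the difference of two consecutive partial sums of its column, and all
  entries outside the index range vanish.\<close>

lemma matrices_eqI:
  assumes "A \<in> matrices m n" "B \<in> matrices m n"
    and cols: "\<And>i j. i \<in> {1..m} \<Longrightarrow> j \<in> {1..n} \<Longrightarrow>
                 (\<Sum>i'=1..i. entry A i' j) = (\<Sum>i'=1..i. entry B i' j)"
  shows "A = B"
proof (rule poly_mapping_eqI)
  fix p :: "nat \<times> nat"
  obtain i j where p: "p = (i, j)" by force
  show "Poly_Mapping.lookup A p = Poly_Mapping.lookup B p"
  proof (cases "p \<in> {1..m} \<times> {1..n}")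
    case False
    then have "p \<notin> Poly_Mapping.keys A" "p \<notin> Poly_Mapping.keys B"
      using assms(1,2) by (auto simp: matrices_def)
    then show ?thesis by (simp add: in_keys_iff)
  next
    case True
    then obtain i' where i: "i = Suc i'" and i': "Suc i' \<le> m" and j: "j \<in> {1..n}"
      using p by (cases i) auto
    \<comment> \<open>For the top row \<open>i'\<close> is 0, which \<open>cols\<close> does not
      cover; both sums are then empty.\<close>
    have "(\<Sum>l=1..i'. entry A l j) = (\<Sum>l=1..i'. entry B l j)"
      using cols[of i' j] i' j by (cases "i' = 0") auto
    moreover have "(\<Sum>l=1..Suc i'. entry A l j) = (\<Sum>l=1..Suc i'. entry B l j)"
      using cols[of "Suc i'" j] i' j by auto
    ultimately show ?thesis by (simp add: p i)
  qed
qed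

lemma linear_column_sum: "linear (\<lambda>M :: rmatrix. \<Sum>i'=1..i. entry M i' j)"
  by (rule linearI) (simp_all add: lookup_add sum.distrib sum_distrib_left)

theorem theorem3p6:
  fixes lam :: "nat list" and n :: nat
  assumes "is_partition lam" and "0 < n"
  shows "{V. V extreme_point_of (sign_matrix_polytope lam n)} = sign_matrices_of lam n"
proof -
  define m where "m = largest_part lam"
  define f where "f = (\<lambda>(i, j) (M :: rmatrix). \<Sum>i'=1..i. entry M i' j)"
  \<comment> \<open>Separation is required on the whole hull, whose points need not be sign matrices
    but still have the right support.\<close>
  have "convex hull (sign_matrices_of lam n) \<subseteq> matrices m n"
    by (intro hull_minimal convex_matrices)
      (auto simp: sign_matrices_of_def sign_matrix_def m_def)
  then have sub: "M \<in> matrices m n" if "M \<in> convex hull (sign_matrices_of lam n)" for M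
    using that by blast
  show ?thesis
    unfolding sign_matrix_polytope_def
  proof (rule extreme_points_convex_hull_zero_one[where f = f and K = "{1..m} \<times> {1..n}"])
    show "linear (f k)" for k
      by (cases k) (simp only: f_def case_prod_conv linear_column_sum)
    \<comment> \<open>This is the column condition in \<open>sign_matrix\<close>, read at the
      position \<open>k\<close>.\<close>
    show "f k M \<in> {0, 1}" if "k \<in> {1..m} \<times> {1..n}" "M \<in> sign_matrices_of lam n" for k M
      using that unfolding sign_matrices_of_def sign_matrix_def m_def
      by (cases k) (simp add: f_def)
    show "A = B" if "A \<in> convex hull (sign_matrices_of lam n)"
        "B \<in> convex hull (sign_matrices_of lam n)"
        and eq: "\<And>k. k \<in> {1..m} \<times> {1..n} \<Longrightarrow> f k A = f k B" for A B
    proof (rule matrices_eqI)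
      show "A \<in> matrices m n" "B \<in> matrices m n"
        using that sub by blast+
      show "(\<Sum>i'=1..i. entry A i' j) = (\<Sum>i'=1..i. entry B i' j)"
        if "i \<in> {1..m}" "j \<in> {1..n}" for i j
        using eq[of "(i, j)"] that unfolding f_def case_prod_conv by blast
    qed
  qed
qed

end
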